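(* Let $d\ge 1$ be a natural number and let $A$ and $B$ be subsets of $\mathbb{Z}^{d}$ such that $\underline{\operatorname{d}}(A)=\alpha>0$ and $\operatorname{BD}(B)>0$. Then for any real $\epsilon$ with $0<\epsilon<\alpha$, the set $A+B$ is lower syndetic of level $\alpha-\epsilon$.
   Context: Intervals denote intervals of integers, $\mathbb{N}$ does not contain $0$, and $A+B=\{a+b:a\in A,b\in B\}$. For $A\subseteq\mathbb{Z}^d$, the lower (asymptotic) density is $\underline{\operatorname{d}}(A)=\liminf_{n\to\infty}\frac{|A\cap[-n,n]^d|}{(2n+1)^d}$, and the (upper) Banach density is $\operatorname{BD}(A)=\lim_{n\to\infty}\sup_{x\in\mathbb{Z}^d}\frac{|A\cap(x+[-n,n]^d)|}{(2n+1)^d}$. For a real number $0<\alpha\le 1$, a set $C\subseteq\mathbb{Z}^d$ is lower syndetic of level $\alpha$ if there exists a natural number $m$ (with $m=0$ allowed) such that for all $k\in\mathbb{N}$, $\underline{\operatorname{d}}(\{z\in\mathbb{Z}^d: z+[-k,k]^d\subseteq C+[-m,m]^d\})\ge\alpha$. *)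

theory Defs
  imports "HOL-Analysis.Analysis" "HOL-Library.Set_Algebras"
begin

text \<open>
  The lattice of integer points in dimension d is the type \<open>int ^ 'd\<close>, with d = \<open>CARD('d)\<close>,
  which is at least 1 for every finite index type. The sum of two sets is the one
  of \<open>Set_Algebras\<close>.
\<close>

definition cube :: "nat \<Rightarrow> (int ^ 'd::finite) set" where
  "cube n = {z. \<forall>i. z $ i \<in> {- int n..int n}}"

definition lower_density :: "(int ^ 'd::finite) set \<Rightarrow> ereal" where
  "lower_density A =
     liminf (\<lambda>n. ereal (real (card (A \<inter> cube n)) / real ((2 * n + 1) ^ CARD('d))))"

text \<open>
  The supremum below is over a set of reals contained in [0, 1], and the limit exists for every
  set, by the usual subadditivity argument.
\<close>

definition banach_density :: "(int ^ 'd::finite) set \<Rightarrow> real" where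
  "banach_density A =
     lim (\<lambda>n. SUP x. real (card (A \<inter> (+) x ` cube n)) / real ((2 * n + 1) ^ CARD('d)))"

definition lower_syndetic :: "real \<Rightarrow> (int ^ 'd::finite) set \<Rightarrow> bool" where
  "lower_syndetic \<alpha> C \<longleftrightarrow>
     0 < \<alpha> \<and> \<alpha> \<le> 1 \<and>
     (\<exists>m::nat. \<forall>k\<ge>1. ereal \<alpha> \<le> lower_density {z. (+) z ` cube k \<subseteq> C + cube m})"

end

theory Submission
  imports Defs "HOL-Real_Asymp.Real_Asymp"
begin

text \<open>
  A box of side \<open>s\<close> whose largest \<open>B\<close>-density is close to the infimum \<open>BD(B)\<close> of these maxima can
  be used to tile a larger box that is optimal for \<open>B\<close>: almost all tiles must then meet \<open>B\<close>, since
  no tile is much denser than the average. Hence \<open>B + [-m, m]\<^sup>d\<close> with \<open>m = s\<close> fills boxes of every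
  size up to a proportion \<open>1 - \<delta>\<close>. On the other side, averaging shows that the translates \<open>z + F\<close> of
  a finite set \<open>F\<close> in which \<open>A\<close> has density at least \<open>\<epsilon>\<close> have lower density at least \<open>\<alpha> - \<epsilon>\<close>
  as a set of \<open>z\<close>. For such \<open>z\<close>, with \<open>F = -x + [-k, k]\<^sup>d\<close> and \<open>\<delta> = \<epsilon> / 2\<^sup>d\<close>, and for \<open>w \<in> z + [-k, k]\<^sup>d\<close>, the
  pigeonhole principle in \<open>w - x + [-2k, 2k]\<^sup>d\<close> makes \<open>A\<close> meet \<open>w - (B + [-m, m]\<^sup>d)\<close>.
\<close>

section \<open>Half-open boxes of arbitrary side and the largest number of points of a set in
  them\<close>

definition lattice_box :: "int ^ 'd \<Rightarrow> nat \<Rightarrow> (int ^ 'd::finite) set" where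
  "lattice_box x s = {z. \<forall>i. x $ i \<le> z $ i \<and> z $ i < x $ i + int s}"

definition max_count :: "(int ^ 'd::finite) set \<Rightarrow> nat \<Rightarrow> nat" where
  "max_count C s = (SUP x. card (C \<inter> lattice_box x s))"

definition box_density :: "(int ^ 'd::finite) set \<Rightarrow> nat \<Rightarrow> real" where
  "box_density C s = real (max_count C s) / real (s ^ CARD('d))"

lemma lattice_box_eq_image:
  "lattice_box x s = vec_lambda ` (\<Pi>\<^sub>E i\<in>UNIV. {x $ i..<x $ i + int s})"
proof -
  have "z \<in> vec_lambda ` (\<Pi>\<^sub>E i\<in>UNIV. {x $ i..<x $ i + int s})"
    if "z \<in> lattice_box x s" for z
    using that by (intro image_eqI[of _ _ "vec_nth z"]) (auto simp: lattice_box_def)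
  then show ?thesis
    by (auto simp: lattice_box_def PiE_iff)
qed

lemma finite_lattice_box [simp]: "finite (lattice_box x s)"
  unfolding lattice_box_eq_image by (intro finite_imageI finite_PiE) auto

lemma card_lattice_box [simp]:
  fixes x :: "int ^ 'd::finite"
  shows "card (lattice_box x s) = s ^ CARD('d)"
proof -
  have "inj_on vec_lambda (\<Pi>\<^sub>E i\<in>UNIV. {x $ i..<x $ i + int s})"
    by (rule inj_onI) (simp add: vec_lambda_inject)
  then show ?thesis
    unfolding lattice_box_eq_image by (simp add: card_image card_PiE)
qed

text \<open>The bridge from centred cubes to boxes given by their lowest corner: cubes are the boxes
  of odd side, while half-open boxes of any side can be cut exactly into smaller ones.\<close>

lemma translate_cube: "(+) x ` cube n = lattice_box (x - (\<chi> i. int n)) (2 * n + 1)"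
proof -
  have "z \<in> (+) x ` cube n" if "z \<in> lattice_box (x - (\<chi> i. int n)) (2 * n + 1)" for z
  proof (rule image_eqI[of _ _ "z - x"])
    show "z - x \<in> cube n"
      using that unfolding cube_def lattice_box_def
      by simp (smt (verit))
  qed simp
  then show ?thesis
    by (auto simp: cube_def lattice_box_def)
qed

lemma translate_cube_iff:
  fixes x :: "int ^ 'd::finite"
  shows "z \<in> (+) x ` cube n \<longleftrightarrow> z - x \<in> cube n"
  by (auto intro: image_eqI[of _ _ "z - x"])

lemma finite_cube [simp]: "finite (cube n)"
  and card_cube [simp]: "card (cube n :: (int ^ 'd::finite) set) = (2 * n + 1) ^ CARD('d)"
proof -
  have eq: "cube n = lattice_box (- (\<chi> i. int n)) (2 * n + 1)"
    using translate_cube[of 0 n] by simp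
  show "finite (cube n)" "card (cube n :: (int ^ 'd) set) = (2 * n + 1) ^ CARD('d)"
    unfolding eq by simp_all
qed

lemma lattice_box_mono: "s \<le> t \<Longrightarrow> lattice_box x s \<subseteq> lattice_box x t"
  by (fastforce simp: lattice_box_def intro: less_le_trans)

lemma bdd_above_box_counts:
  fixes C :: "(int ^ 'd::finite) set"
  shows "bdd_above (range (\<lambda>x. card (C \<inter> lattice_box x s)))"
proof (rule bdd_aboveI2)
  fix x :: "int ^ 'd"
  show "card (C \<inter> lattice_box x s) \<le> s ^ CARD('d)"
    using card_mono[of "lattice_box x s" "C \<inter> lattice_box x s"] by simp
qed

lemma card_le_max_count: "card (C \<inter> lattice_box x s) \<le> max_count C s"
  unfolding max_count_def using bdd_above_box_counts by (rule cSUP_upper2) auto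

lemma max_count_attained: "\<exists>x. card (C \<inter> lattice_box x s) = max_count C s"
proof -
  have "max_count C s \<in> range (\<lambda>x. card (C \<inter> lattice_box x s))"
    using bdd_above_box_counts[of C s]
    by (auto simp: max_count_def bdd_above_nat cSup_eq_Max intro!: Max_in)
  then show ?thesis by auto
qed

lemma max_count_mono: "s \<le> t \<Longrightarrow> max_count C s \<le> max_count C t"
proof -
  assume st: "s \<le> t"
  obtain x where x: "card (C \<inter> lattice_box x s) = max_count C s"
    using max_count_attained by blast
  have "card (C \<inter> lattice_box x s) \<le> card (C \<inter> lattice_box x t)"
    using lattice_box_mono[OF st] by (intro card_mono) auto
  with x card_le_max_count[of C x t] show ?thesis by linarith
qed

section \<open>Tilings, subadditivity and the Banach density as an infimum\<close>

lemma div_eq_iff_int: "s > 0 \<Longrightarrow> (y::int) div s = t \<longleftrightarrow> s * t \<le> y \<and> y < s * t + s"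
proof
  assume "s > 0" "y div s = t"
  then have "s * t + y mod s = y" "0 \<le> y mod s" "y mod s < s"
    by auto
  then show "s * t \<le> y \<and> y < s * t + s"
    by linarith
next
  assume "s > 0" "s * t \<le> y \<and> y < s * t + s"
  then show "y div s = t"
    by (intro int_div_pos_eq[of y s t "y - s * t"]) auto
qed

text \<open>The points are grouped by the integer quotients of the coordinates of
  \<open>z - x\<close> by \<open>s\<close>; the fibre over \<open>t\<close> is the tile with corner
  \<open>x + int s *s t\<close>.\<close>

lemma card_lattice_box_tiling:
  fixes C :: "(int ^ 'd::finite) set"
  assumes "s > 0"
  shows "card (C \<inter> lattice_box x (q * s)) =
    (\<Sum>t\<in>lattice_box 0 q. card (C \<inter> lattice_box (x + int s *s t) s))"
proof -
  let ?g = "\<lambda>z :: int ^ 'd. \<chi> i. (z $ i - x $ i) div int s"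
  have g: "?g z \<in> lattice_box 0 q" if "z \<in> lattice_box x (q * s)" for z
  proof -
    have "(z $ i - x $ i) div int s < int q" for i
    proof -
      have "(z $ i - x $ i) div int s * int s \<le> z $ i - x $ i"
        using assms by (simp add: minus_mod_eq_div_mult[symmetric])
      also have "\<dots> < int q * int s"
        using that by (simp add: lattice_box_def algebra_simps)
      finally show ?thesis using assms by simp
    qed
    then show ?thesis
      using that assms by (auto simp: lattice_box_def pos_imp_zdiv_nonneg_iff)
  qed
  have fib: "{z \<in> C \<inter> lattice_box x (q * s). ?g z = t} = C \<inter> lattice_box (x + int s *s t) s"
    if t: "t \<in> lattice_box 0 q" for t
  proof -
    have 1: "?g z = t \<longleftrightarrow> z \<in> lattice_box (x + int s *s t) s" for z
      using assms by (auto simp: vec_eq_iff div_eq_iff_int lattice_box_def; smt (verit))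
    have 2: "z \<in> lattice_box x (q * s)" if z: "z \<in> lattice_box (x + int s *s t) s" for z
      unfolding lattice_box_def
    proof (intro CollectI allI conjI)
      fix i
      have "0 \<le> t $ i" "t $ i < int q" using t by (auto simp: lattice_box_def)
      then have ti: "0 \<le> t $ i" "t $ i + 1 \<le> int q" by auto
      have zi: "x $ i + int s * t $ i \<le> z $ i" "z $ i < x $ i + int s * t $ i + int s"
        using z by (auto simp: lattice_box_def)
      have "0 \<le> int s * t $ i" using ti by simp
      then show "x $ i \<le> z $ i" using zi by linarith
      have "int s * (t $ i + 1) \<le> int s * int q" using ti by (intro mult_left_mono) auto
      then show "z $ i < x $ i + int (q * s)" using zi by (simp add: algebra_simps)
    qed
    show ?thesis using 1 2 by blast
  qed
  have "card (C \<inter> lattice_box x (q * s)) = (\<Sum>z\<in>C \<inter> lattice_box x (q * s). 1)"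
    by simp
  also have "\<dots> = (\<Sum>t\<in>lattice_box 0 q. \<Sum>z | z \<in> C \<inter> lattice_box x (q * s) \<and> ?g z = t. 1)"
    using g by (intro sum.group[symmetric]) auto
  also have "\<dots> = (\<Sum>t\<in>lattice_box 0 q. card (C \<inter> lattice_box (x + int s *s t) s))"
    using fib by (intro sum.cong) auto
  finally show ?thesis .
qed

lemma max_count_mult_le:
  fixes C :: "(int ^ 'd::finite) set"
  assumes "s > 0"
  shows "max_count C (q * s) \<le> q ^ CARD('d) * max_count C s"
proof -
  obtain x where x: "card (C \<inter> lattice_box x (q * s)) = max_count C (q * s)"
    using max_count_attained by blast
  have "card (C \<inter> lattice_box x (q * s)) \<le> (\<Sum>t\<in>(lattice_box 0 q :: (int ^ 'd) set). max_count C s)"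
    unfolding card_lattice_box_tiling[OF assms] by (intro sum_mono card_le_max_count)
  with x show ?thesis by simp
qed

lemma box_density_nonneg: "box_density C s \<ge> 0"
  by (simp add: box_density_def)

text \<open>The side \<open>N\<close> is rounded up to a multiple \<open>q * s\<close> with
  \<open>q * s \<le> N + s\<close>, and the larger box is tiled. The error factor tends to 1 for
  fixed \<open>s\<close> and growing \<open>N\<close>.\<close>

lemma box_density_le:
  fixes C :: "(int ^ 'd::finite) set"
  assumes "s > 0" "N > 0"
  shows "box_density C N \<le> box_density C s * (1 + real s / real N) ^ CARD('d)"
proof -
  define q where "q = N div s + 1"
  have "N \<le> q * s"
    unfolding q_def using assms
    by (metis Suc_eq_plus1 dividend_less_div_times less_imp_le mult.commute add.commute mult_Suc)
  then have "max_count C N \<le> q ^ CARD('d) * max_count C s"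
    using max_count_mono max_count_mult_le[OF assms(1)] order_trans by blast
  then have "real (max_count C N) \<le> real (q ^ CARD('d) * max_count C s)"
    by (rule of_nat_mono)
  then have "box_density C N \<le> real q ^ CARD('d) * real (max_count C s) / real N ^ CARD('d)"
    using assms by (simp add: box_density_def divide_right_mono)
  also have "\<dots> = box_density C s * (real (q * s) / real N) ^ CARD('d)"
    using assms by (simp add: box_density_def field_simps power_mult_distrib power_divide)
  also have "\<dots> \<le> box_density C s * (1 + real s / real N) ^ CARD('d)"
  proof (intro mult_left_mono power_mono box_density_nonneg)
    have "q * s \<le> N + s" unfolding q_def by simp
    then have "real (q * s) \<le> real N + real s" by linarith
    then show "real (q * s) / real N \<le> 1 + real s / real N"
      using assms by (simp add: field_simps)
  qed simp
  finally show ?thesis .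
qed

text \<open>Side 0 is excluded: there the quotient is 0 / 0 = 0, which would make every infimum
  0.\<close>

definition inf_density :: "(int ^ 'd::finite) set \<Rightarrow> real" where
  "inf_density C = (INF s\<in>{1..}. box_density C s)"

lemma inf_density_le: "s > 0 \<Longrightarrow> inf_density C \<le> box_density C s"
  unfolding inf_density_def
  by (rule cINF_lower) (auto intro: bdd_belowI2[of _ 0] box_density_nonneg)

lemma inf_density_lessD:
  assumes "inf_density C < r"
  obtains s where "s > 0" "box_density C s < r"
proof -
  have "\<exists>s\<in>{1..}. box_density C s < r"
    using assms unfolding inf_density_def
    by (subst (asm) cINF_less_iff) (auto intro: bdd_belowI2[of _ 0] box_density_nonneg)
  with that show thesis by (metis atLeast_iff less_le_trans zero_less_one)
qed

text \<open>Fekete's argument: the infimum bounds every term from below, and a single side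
  \<open>s\<close> with density below \<open>r\<close> forces all large sides below \<open>r\<close>
  through \<open>box_density_le\<close>. Odd sides suffice, since these belong to cubes.\<close>

lemma box_density_tendsto:
  fixes C :: "(int ^ 'd::finite) set"
  shows "(\<lambda>n. box_density C (2 * n + 1)) \<longlonglongrightarrow> inf_density C"
proof (rule order_tendstoI)
  fix r assume "r < inf_density C"
  then show "\<forall>\<^sub>F n in sequentially. r < box_density C (2 * n + 1)"
    by (intro always_eventually allI less_le_trans[OF _ inf_density_le]) auto
next
  fix r assume "inf_density C < r"
  then obtain s where s: "s > 0" "box_density C s < r"
    by (rule inf_density_lessD)
  have "(\<lambda>n. real s / real (2 * n + 1)) \<longlonglongrightarrow> 0"
    by real_asymp
  then have "(\<lambda>n. box_density C s * (1 + real s / real (2 * n + 1)) ^ CARD('d))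
          \<longlonglongrightarrow> box_density C s * (1 + 0) ^ CARD('d)"
    by (intro tendsto_intros)
  with s(2) have "\<forall>\<^sub>F n in sequentially.
      box_density C s * (1 + real s / real (2 * n + 1)) ^ CARD('d) < r"
    by (intro order_tendstoD(2)) auto
  then show "\<forall>\<^sub>F n in sequentially. box_density C (2 * n + 1) < r"
    by (rule eventually_mono) (rule le_less_trans[OF box_density_le[OF s(1)]], simp)
qed

text \<open>For each radius the supremum over centres is attained, at the centre of an optimal box
  of side \<open>2 * n + 1\<close>, so the defining sequence is the one of
  \<open>box_density_tendsto\<close>.\<close>

lemma banach_density_eq:
  fixes C :: "(int ^ 'd::finite) set"
  shows "banach_density C = inf_density C"
proof -
  have "(SUP x. real (card (C \<inter> (+) x ` cube n)) / real ((2 * n + 1) ^ CARD('d))) =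
      box_density C (2 * n + 1)" for n
  proof (rule cSup_eq_maximum)
    obtain x where "card (C \<inter> lattice_box x (2 * n + 1)) = max_count C (2 * n + 1)"
      using max_count_attained by blast
    then have "card (C \<inter> (+) (x + (\<chi> i. int n)) ` cube n) = max_count C (2 * n + 1)"
      by (simp add: translate_cube)
    then show "box_density C (2 * n + 1)
        \<in> range (\<lambda>x. real (card (C \<inter> (+) x ` cube n)) / real ((2 * n + 1) ^ CARD('d)))"
      by (intro image_eqI[of _ _ "x + (\<chi> i. int n)"]) (simp_all add: box_density_def)
  next
    fix y assume "y \<in> range (\<lambda>x. real (card (C \<inter> (+) x ` cube n)) / real ((2 * n + 1) ^ CARD('d)))"
    then show "y \<le> box_density C (2 * n + 1)"
      unfolding box_density_def translate_cube
      by (auto intro!: divide_right_mono card_le_max_count)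
  qed
  then show ?thesis
    unfolding banach_density_def by (simp only: limI[OF box_density_tendsto])
qed

section \<open>Thickening a set of positive Banach density\<close>

lemma lattice_box_subset_plus_cube:
  assumes "b \<in> B" "b \<in> lattice_box x s"
  shows "lattice_box x s \<subseteq> B + cube s"
proof
  fix z assume z: "z \<in> lattice_box x s"
  have "z - b \<in> cube s"
    unfolding cube_def
  proof (intro CollectI allI)
    fix i
    have "x $ i \<le> z $ i" "z $ i < x $ i + int s" "x $ i \<le> b $ i" "b $ i < x $ i + int s"
      using z assms(2) by (auto simp: lattice_box_def)
    then show "(z - b) $ i \<in> {- int s..int s}" by simp
  qed
  then show "z \<in> B + cube s"
    using assms(1) set_plus_intro[of b B "z - b" "cube s"] by simp
qed

text \<open>One \<open>m\<close> serves all \<open>n\<close>. An optimal box of side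
  \<open>n * s\<close> is tiled in two ways: \<open>n ^ d\<close> tiles of side \<open>s\<close>
  show that the thickened set nearly fills it, and \<open>s ^ d\<close> boxes of side
  \<open>n\<close> then include one that is at least as full as the average.\<close>

lemma thickening_fills_boxes:
  fixes B :: "(int ^ 'd::finite) set"
  assumes pos: "banach_density B > 0" and "\<delta> > 0"
  obtains m where "\<And>n. n > 0 \<Longrightarrow>
    \<exists>x. (1 - \<delta>) * real (n ^ CARD('d)) < real (card ((B + cube m) \<inter> lattice_box x n))"
proof -
  let ?L = "inf_density B"
  have L: "?L > 0" using pos by (simp add: banach_density_eq)
  obtain s where s: "s > 0" "(1 - \<delta>) * box_density B s < ?L"
  \<comment> \<open>A side nearly attaining the infimum works if \<delta> < 1; otherwise the left
    side is at most 0 and any \<open>s\<close> will do.\<close>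
  proof (cases "\<delta> < 1")
    case True
    have "?L < ?L / (1 - \<delta>)" using True L \<open>\<delta> > 0\<close> by (simp add: field_simps)
    then obtain s where "s > 0" "box_density B s < ?L / (1 - \<delta>)" by (rule inf_density_lessD)
    with that True show ?thesis by (simp add: field_simps)
  next
    case False
    then have "(1 - \<delta>) * box_density B 1 \<le> 0"
      by (simp add: mult_nonpos_nonneg box_density_nonneg)
    with L that[of 1] show ?thesis by simp
  qed
  \<comment> \<open>A tile that misses \<open>B\<close> makes the left side 0; a tile that meets
    \<open>B\<close> is filled by the thickening, and its count is at most the maximum.\<close>
  have hit: "s ^ CARD('d) * card (B \<inter> lattice_box x s)
      \<le> max_count B s * card ((B + cube s) \<inter> lattice_box x s)" for x
  proof (cases "B \<inter> lattice_box x s = {}")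
    case False
    then have "(B + cube s) \<inter> lattice_box x s = lattice_box x s"
      using lattice_box_subset_plus_cube by blast
    then show ?thesis by (simp add: card_le_max_count)
  qed simp
  show thesis
  proof (rule that[of s])
    fix n :: nat assume n: "n > 0"
    obtain x where x: "card (B \<inter> lattice_box x (n * s)) = max_count B (n * s)"
      using max_count_attained by blast
    have "s ^ CARD('d) * card (B \<inter> lattice_box x (n * s)) =
        (\<Sum>t\<in>lattice_box 0 n. s ^ CARD('d) * card (B \<inter> lattice_box (x + int s *s t) s))"
      by (simp add: card_lattice_box_tiling[OF s(1)] sum_distrib_left)
    also have "\<dots> \<le> (\<Sum>t\<in>lattice_box 0 n.
        max_count B s * card ((B + cube s) \<inter> lattice_box (x + int s *s t) s))"
      by (intro sum_mono hit)
    also have "\<dots> = max_count B s * card ((B + cube s) \<inter> lattice_box x (n * s))"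
      by (simp add: card_lattice_box_tiling[OF s(1)] sum_distrib_left)
    also have "\<dots> \<le> max_count B s * max_count (B + cube s) (n * s)"
      by (intro mult_left_mono card_le_max_count) auto
    \<comment> \<open>Here the box of side \<open>n * s\<close> is cut the other way, into
      \<open>s ^ d\<close> boxes of side \<open>n\<close>.\<close>
    also have "\<dots> \<le> max_count B s * (s ^ CARD('d) * max_count (B + cube s) n)"
      using max_count_mult_le[OF n, of "B + cube s" s] by (simp add: mult.commute)
    finally have "max_count B (n * s) \<le> max_count B s * max_count (B + cube s) n"
      using s(1) x by (simp add: algebra_simps)
    then have "real (max_count B (n * s)) \<le> real (max_count B s * max_count (B + cube s) n)"
      by (rule of_nat_mono)
    then have "box_density B (n * s) \<le> box_density B s * box_density (B + cube s) n"
      using s(1) n by (simp add: box_density_def field_simps power_mult_distrib)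
    moreover have "?L \<le> box_density B (n * s)" using s(1) n by (intro inf_density_le) simp
    ultimately have "(1 - \<delta>) * box_density B s < box_density B s * box_density (B + cube s) n"
      using s(2) by linarith
    then have "1 - \<delta> < box_density (B + cube s) n"
      using mult_left_mono[OF _ box_density_nonneg[of B s], of "box_density (B + cube s) n" "1 - \<delta>"]
      by (metis mult.commute not_le)
    then have *: "(1 - \<delta>) * real (n ^ CARD('d)) < real (max_count (B + cube s) n)"
      using n by (simp add: box_density_def field_simps)
    obtain y where "card ((B + cube s) \<inter> lattice_box y n) = max_count (B + cube s) n"
      using max_count_attained by blast
    with * show "\<exists>x. (1 - \<delta>) * real (n ^ CARD('d)) < real (card ((B + cube s) \<inter> lattice_box x n))"
      by metis
  qed
qed

section \<open>Averaging over the translates of a finite set\<close>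

lemma sum_card_translates_ge:
  fixes A :: "(int ^ 'd::finite) set"
  assumes F: "finite F" "F \<subseteq> cube r"
  shows "card F * card (A \<inter> cube N) \<le> (\<Sum>z\<in>cube (N + r). card (A \<inter> (+) z ` F))"
proof -
  have "card F * card (A \<inter> cube N) = card (F \<times> (A \<inter> cube N))"
    by (simp add: card_cartesian_product)
  also have "\<dots> \<le> card (SIGMA z:cube (N + r). A \<inter> (+) z ` F)"
  proof (rule card_inj_on_le)
    \<comment> \<open>Double counting: a pair (f, a) names the translate by \<open>a - f\<close>,
      which contains \<open>a\<close>. Enlarging the cube by \<open>r\<close> ensures that no pair
      is lost at the boundary.\<close>
    let ?h = "\<lambda>(f, a). (a - f, a) :: (int ^ 'd) \<times> (int ^ 'd)"
    show "inj_on ?h (F \<times> (A \<inter> cube N))" by (auto simp: inj_on_def)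
    have "a - f \<in> cube (N + r)" if "f \<in> F" "a \<in> cube N" for f a
    proof -
      have "f \<in> cube r" using that F by blast
      then have "\<forall>i. - int r \<le> f $ i \<and> f $ i \<le> int r" "\<forall>i. - int N \<le> a $ i \<and> a $ i \<le> int N"
        using that by (auto simp: cube_def)
      then show ?thesis unfolding cube_def by simp (smt (verit))
    qed
    moreover have "a \<in> (+) (a - f) ` F" if "f \<in> F" for a f
      using that by (auto intro: image_eqI[of _ _ f])
    ultimately show "?h ` (F \<times> (A \<inter> cube N)) \<subseteq> (SIGMA z:cube (N + r). A \<inter> (+) z ` F)"
      by auto
    show "finite (SIGMA z:cube (N + r). A \<inter> (+) z ` F)"
      using F by (intro finite_SigmaI) auto
  qed
  also have "\<dots> = (\<Sum>z\<in>cube (N + r). card (A \<inter> (+) z ` F))"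
    using F by (intro card_SigmaI) auto
  finally show ?thesis .
qed

lemma finite_subset_cube:
  fixes F :: "(int ^ 'd::finite) set"
  assumes "finite F"
  obtains r where "F \<subseteq> cube r"
proof -
  define r where "r = (\<Sum>f\<in>F. \<Sum>i\<in>UNIV. nat \<bar>f $ i\<bar>)"
  have "nat \<bar>f $ i\<bar> \<le> r" if "f \<in> F" for f i
  proof -
    have "nat \<bar>f $ i\<bar> \<le> (\<Sum>i\<in>UNIV. nat \<bar>f $ i\<bar>)" by (rule member_le_sum) auto
    also have "\<dots> \<le> r" unfolding r_def using assms that by (intro member_le_sum) auto
    finally show ?thesis .
  qed
  then have "F \<subseteq> cube r"
    by (auto simp: cube_def nat_le_iff abs_le_iff) (metis minus_le_iff)
  with that show thesis .
qed

text \<open>On average a translate has \<open>A\<close>-density about \<alpha>, up to a boundary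
  effect that vanishes in the limit. Translates outside the set contribute less than \<epsilon> each
  and those inside at most 1, so the latter must have proportion at least \<alpha> -
  \<epsilon>.\<close>

lemma lower_density_rich_translates:
  fixes A F :: "(int ^ 'd::finite) set"
  assumes A: "lower_density A = ereal \<alpha>" and F: "finite F" "F \<noteq> {}" and "\<epsilon> > 0"
  shows "ereal (\<alpha> - \<epsilon>) \<le> lower_density {z. \<epsilon> * real (card F) \<le> real (card (A \<inter> (+) z ` F))}"
    (is "_ \<le> lower_density ?G")
proof -
  obtain r where r: "F \<subseteq> cube r" using F(1) by (rule finite_subset_cube)
  let ?d = "CARD('d)"
  let ?w = "\<lambda>N. real ((2 * N + 1) ^ ?d)"
  have count: "real (card (A \<inter> cube N)) \<le> real (card (?G \<inter> cube (N + r))) + \<epsilon> * ?w (N + r)" for N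
  proof -
    have cF: "card F > 0" using F by (simp add: card_gt_0_iff)
    have "real (card F) * real (card (A \<inter> cube N)) \<le> (\<Sum>z\<in>cube (N + r). real (card (A \<inter> (+) z ` F)))"
      using of_nat_mono[OF sum_card_translates_ge[OF F(1) r, of A N], where 'a = real] by simp
    also have "\<dots> \<le> (\<Sum>z\<in>cube (N + r). real (card F) * (indicator ?G z + \<epsilon>))"
    proof (rule sum_mono)
      fix z
      have "card (A \<inter> (+) z ` F) \<le> card ((+) z ` F)" using F by (intro card_mono) auto
      also have "\<dots> = card F" by (simp add: card_image)
      finally show "real (card (A \<inter> (+) z ` F)) \<le> real (card F) * (indicator ?G z + \<epsilon>)"
        using \<open>\<epsilon> > 0\<close> cF by (auto simp: indicator_def algebra_simps intro: add_increasing2)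
    qed
    also have "\<dots> = real (card F) * ((\<Sum>z\<in>cube (N + r). indicator ?G z) + \<epsilon> * ?w (N + r))"
      by (simp add: sum_distrib_left[symmetric] sum.distrib)
    also have "(\<Sum>z\<in>cube (N + r). indicator ?G z) = real (card (?G \<inter> cube (N + r)))"
      using arg_cong[OF sum_indicator_eq_card[of "cube (N + r)" ?G], of real]
      by (simp add: real_of_nat_indicator Int_commute)
    finally show ?thesis using cF by simp
  qed
  show ?thesis
    unfolding lower_density_def
  proof (subst le_Liminf_iff, intro allI impI)
    fix y :: ereal assume "y < ereal (\<alpha> - \<epsilon>)"
    \<comment> \<open>The bound \<open>y\<close> may be minus infinity, so a real \<open>t\<close>
      replaces it.\<close>
    then obtain t where t: "y \<le> ereal t" "t < \<alpha> - \<epsilon>"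
      by (cases y) (auto intro: that[of "\<alpha> - \<epsilon> - 1"])
    \<comment> \<open>The midpoint of \<open>t + \<epsilon>\<close> and \<alpha> leaves room both
      below the density of \<open>A\<close> and for the boundary factor, which is only close to
      1.\<close>
    define a where "a = (t + \<epsilon> + \<alpha>) / 2"
    have a: "a < \<alpha>" "t < a - \<epsilon>" using t by (auto simp: a_def field_simps)
    have "ereal a < lower_density A"
      using A a(1) by simp
    then have "\<forall>\<^sub>F N in sequentially. ereal a < ereal (real (card (A \<inter> cube N)) / ?w N)"
      unfolding lower_density_def by (rule less_LiminfD)
    then have evA: "\<forall>\<^sub>F N in sequentially. a < real (card (A \<inter> cube N)) / ?w N"
      by (simp only: less_ereal.simps)
    have "(\<lambda>N. a * (real (2 * N + 1) / real (2 * (N + r) + 1)) ^ ?d - \<epsilon>) \<longlonglongrightarrow> a * 1 ^ ?d - \<epsilon>"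
      by (intro tendsto_intros) real_asymp
    with a(2) have "\<forall>\<^sub>F N in sequentially.
        t < a * (real (2 * N + 1) / real (2 * (N + r) + 1)) ^ ?d - \<epsilon>"
      by (intro order_tendstoD(1)) auto
    with evA have "\<forall>\<^sub>F N in sequentially.
        t < real (card (?G \<inter> cube (N + r))) / ?w (N + r)"
    proof eventually_elim
      case (elim N)
      have w: "?w N > 0" "?w (N + r) > 0" by simp_all
      have "a * ?w N < real (card (A \<inter> cube N))" using elim(1) w by (simp only: pos_less_divide_eq)
      with count[of N] have "a * ?w N - \<epsilon> * ?w (N + r) < real (card (?G \<inter> cube (N + r)))" by linarith
      moreover have "t * ?w (N + r) < a * ?w N - \<epsilon> * ?w (N + r)"
      proof -
        have "t < a * (?w N / ?w (N + r)) - \<epsilon>" using elim(2) by (simp only: power_divide of_nat_power)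
        then have "t * ?w (N + r) < (a * (?w N / ?w (N + r)) - \<epsilon>) * ?w (N + r)"
          using w(2) by (rule mult_strict_right_mono)
        also have "\<dots> = a * ?w N - \<epsilon> * ?w (N + r)"
          using w(2) by (simp only: left_diff_distrib) simp
        finally show ?thesis .
      qed
      ultimately have "t * ?w (N + r) < real (card (?G \<inter> cube (N + r)))" by linarith
      then show ?case using w(2) by (simp only: pos_less_divide_eq)
    qed
    then have "\<forall>\<^sub>F N in sequentially. t < real (card (?G \<inter> cube N)) / ?w N"
      by (rule eventually_sequentially_seg[THEN iffD1])
    then show "\<forall>\<^sub>F N in sequentially. y < ereal (real (card (?G \<inter> cube N)) / ?w N)"
      by (rule eventually_mono) (use t(1) in \<open>auto intro: le_less_trans\<close>)
  qed
qed

section \<open>Bounds for lower density, the pigeonhole step and the conclusion\<close>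

lemma lower_density_mono: "A \<subseteq> B \<Longrightarrow> lower_density A \<le> lower_density B"
  unfolding lower_density_def
  by (intro Liminf_mono always_eventually allI)
     (auto intro!: divide_right_mono card_mono)

lemma lower_density_le_1: "lower_density (A :: (int ^ 'd::finite) set) \<le> 1"
proof -
  have "lower_density A \<le> lower_density (UNIV :: (int ^ 'd) set)"
    by (rule lower_density_mono) simp
  also have "\<dots> = 1" by (simp add: lower_density_def Liminf_const one_ereal_def)
  finally show ?thesis .
qed

text \<open>Pigeonhole principle: the part of \<open>A\<close> and the reflected part
  \<open>w - B'\<close> both lie in a cube of radius \<open>2 * k\<close> around
  \<open>w - x\<close>, and their sizes add up to more than its size. A common point
  \<open>a = w - b\<close> gives \<open>w = a + b\<close>.\<close>

lemma rich_translate_fills: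
  fixes A B' :: "(int ^ 'd::finite) set"
  assumes rich: "\<epsilon> * real ((2 * k + 1) ^ CARD('d)) \<le> real (card (A \<inter> (+) (z - x) ` cube k))"
    and full: "(1 - \<epsilon> / 2 ^ CARD('d)) * real ((4 * k + 1) ^ CARD('d))
      < real (card (B' \<inter> (+) x ` cube (2 * k)))"
    and "\<epsilon> > 0" "w \<in> (+) z ` cube k"
  shows "w \<in> A + B'"
proof -
  let ?P = "A \<inter> (+) (z - x) ` cube k" and ?Q = "(-) w ` (B' \<inter> (+) x ` cube (2 * k))"
  let ?W = "(+) (w - x) ` cube (2 * k)"
  have neg: "- u \<in> cube n" if "u \<in> cube n" for u :: "int ^ 'd" and n
    using that by (auto simp: cube_def) (smt (verit))
  \<comment> \<open>The radius doubles because \<open>a\<close> is within \<open>k\<close> of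
    \<open>z - x\<close> and \<open>w\<close> is within \<open>k\<close> of
    \<open>z\<close>.\<close>
  have "?P \<subseteq> ?W"
  proof
    fix a assume "a \<in> ?P"
    then have "a - (z - x) \<in> cube k" "w - z \<in> cube k"
      using assms(4) by (auto simp: translate_cube_iff)
    then have *: "\<And>i. - int k \<le> a $ i - (z $ i - x $ i) \<and> a $ i - (z $ i - x $ i) \<le> int k"
      "\<And>i. - int k \<le> w $ i - z $ i \<and> w $ i - z $ i \<le> int k"
      by (auto simp: cube_def)
    have "a - (w - x) \<in> cube (2 * k)"
      unfolding cube_def
    proof (intro CollectI allI)
      fix i show "(a - (w - x)) $ i \<in> {- int (2 * k)..int (2 * k)}"
        using *(1)[of i] *(2)[of i] by simp
    qed
    then show "a \<in> ?W" by (simp add: translate_cube_iff)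
  qed
  moreover have "?Q \<subseteq> ?W"
  proof -
    have "w - (x + u) \<in> ?W" if "u \<in> cube (2 * k)" for u
      using neg[OF that] by (simp add: translate_cube_iff)
    then show ?thesis by auto
  qed
  ultimately have "card (?P \<union> ?Q) \<le> card ?W" by (intro card_mono) auto
  also have "\<dots> = (4 * k + 1) ^ CARD('d)" by (simp add: card_image)
  finally have cW: "real (card (?P \<union> ?Q)) \<le> real ((4 * k + 1) ^ CARD('d))" by (rule of_nat_mono)
  have cQ: "card ?Q = card (B' \<inter> (+) x ` cube (2 * k))" by (intro card_image) (auto simp: inj_on_def)
  \<comment> \<open>This comparison of sides is the source of the factor
    \<open>2 ^ CARD('d)\<close>: what \<open>B'\<close> misses in the large cube is less than what
    \<open>A\<close> has in the small one.\<close>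
  have "real (4 * k + 1) ^ CARD('d) \<le> (2 * real (2 * k + 1)) ^ CARD('d)" by (intro power_mono) auto
  then have "\<epsilon> / 2 ^ CARD('d) * real (4 * k + 1) ^ CARD('d)
      \<le> \<epsilon> / 2 ^ CARD('d) * (2 * real (2 * k + 1)) ^ CARD('d)"
    using \<open>\<epsilon> > 0\<close> by (intro mult_left_mono) auto
  also have "\<dots> = \<epsilon> * real ((2 * k + 1) ^ CARD('d))"
    unfolding power_mult_distrib of_nat_power by simp
  finally have "real ((4 * k + 1) ^ CARD('d)) < real (card ?P) + real (card ?Q)"
    using rich full unfolding cQ of_nat_power left_diff_distrib by linarith
  with cW have "card (?P \<union> ?Q) \<noteq> card ?P + card ?Q" by linarith
  then obtain a where "a \<in> ?P \<inter> ?Q" using card_Un_disjoint[of ?P ?Q] by auto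
  then obtain b where "b \<in> B'" "a \<in> A" "a = w - b" by auto
  then show ?thesis using set_plus_intro[of a A b B'] by simp
qed

theorem theorem4p3:
  fixes A B :: "(int ^ 'd::finite) set" and \<alpha> \<epsilon> :: real
  assumes "lower_density A = ereal \<alpha>" and "\<alpha> > 0"
    and "banach_density B > 0"
    and "0 < \<epsilon>" and "\<epsilon> < \<alpha>"
  shows "lower_syndetic (\<alpha> - \<epsilon>) (A + B)"
proof -
  have "\<alpha> \<le> 1" using lower_density_le_1[of A] assms(1) by simp
  \<comment> \<open>The thickening is fixed before \<open>k\<close>, as the order of quantifiers in
    \<open>lower_syndetic\<close> demands.\<close>
  obtain m where m: "\<And>n. n > 0 \<Longrightarrow> \<exists>x. (1 - \<epsilon> / 2 ^ CARD('d)) * real (n ^ CARD('d))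
      < real (card ((B + cube m) \<inter> lattice_box x n))"
    using thickening_fills_boxes[OF assms(3), of "\<epsilon> / 2 ^ CARD('d)"] assms(4) by auto
  have "ereal (\<alpha> - \<epsilon>) \<le> lower_density {z. (+) z ` cube k \<subseteq> (A + B) + cube m}" for k
  proof -
    obtain x0 where "(1 - \<epsilon> / 2 ^ CARD('d)) * real ((4 * k + 1) ^ CARD('d))
        < real (card ((B + cube m) \<inter> lattice_box x0 (4 * k + 1)))"
      using m[of "4 * k + 1"] by auto
    \<comment> \<open>From the corner \<open>x0\<close> to the centre of the box, whose side is
      \<open>4 * k + 1 = 2 * (2 * k) + 1\<close>.\<close>
    moreover define x where "x = x0 + (\<chi> i. int (2 * k))"
    ultimately have x: "(1 - \<epsilon> / 2 ^ CARD('d)) * real ((4 * k + 1) ^ CARD('d))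
        < real (card ((B + cube m) \<inter> (+) x ` cube (2 * k)))"
      by (simp add: translate_cube)
    \<comment> \<open>The set depends on \<open>k\<close> and \<open>x\<close> but not on
      \<open>z\<close>, so the averaging lemma applies; its translate by \<open>z\<close> is the
      cube of radius \<open>k\<close> around \<open>z - x\<close>.\<close>
    let ?F = "(+) (- x) ` cube k"
    let ?G = "{z. \<epsilon> * real (card ?F) \<le> real (card (A \<inter> (+) z ` ?F))}"
    have "cube k \<noteq> ({} :: (int ^ 'd) set)" by (auto simp: cube_def intro: exI[of _ 0])
    then have "ereal (\<alpha> - \<epsilon>) \<le> lower_density ?G"
      using assms by (intro lower_density_rich_translates) auto
    also have "\<dots> \<le> lower_density {z. (+) z ` cube k \<subseteq> (A + B) + cube m}"
    proof (intro lower_density_mono subsetI CollectI)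
      fix z w assume z: "z \<in> ?G" and w: "w \<in> (+) z ` cube k"
      have "(+) z ` ?F = (+) (z - x) ` cube k" by (simp add: image_image algebra_simps)
      moreover have "card ?F = (2 * k + 1) ^ CARD('d)" by (simp add: card_image)
      ultimately have "\<epsilon> * real ((2 * k + 1) ^ CARD('d)) \<le> real (card (A \<inter> (+) (z - x) ` cube k))"
        using z by simp
      then have "w \<in> A + (B + cube m)" using x assms(4) w by (rule rich_translate_fills)
      \<comment> \<open>Associativity moves the thickening from \<open>B\<close> to the
        sumset.\<close>
      then show "w \<in> (A + B) + cube m" by (simp add: add.assoc)
    qed
    finally show ?thesis .
  qed
  with assms \<open>\<alpha> \<le> 1\<close> show ?thesis by (auto simp: lower_syndetic_def)
qed

end
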